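(* Let $\phi:\mathbb{C}\times\mathbb{H}\to\mathbb{C}$ be a (not necessarily holomorphic) function satisfying the same transformation laws as Jacobi forms of weight $k$ and index $m$ ($k,m\in\mathbb{N}$) on the full modular group $\mathrm{SL}_2(\mathbb{Z})$ without multiplier, and having an expansion of the form $$\phi(z;\tau)=:\sum_{n}\chi_n(\overline{z};\tau)\,z^n .$$ Then $$ \psi_n(\tau) := \sum_{j \geq 0} \frac{\left(\frac{\pi m }{v}\right)^j}{j!}\,\chi_{n-2j}(0;\tau) $$ transforms like a modular form of weight $k+n$, i.e. $\psi_n\left(\frac{a\tau+b}{c\tau+d}\right)=(c\tau+d)^{k+n}\psi_n(\tau)$ for all $\left(\begin{smallmatrix}a&b\\c&d\end{smallmatrix}\right)\in\mathrm{SL}_2(\mathbb{Z})$.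
   Context: Notation: $\mathbb{H}$ is the complex upper half-plane, $z\in\mathbb{C}$, $\tau=u+iv\in\mathbb{H}$ with $u,v\in\mathbb{R}$. The transformation laws of a Jacobi form of weight $k$ and index $m$ on $\mathrm{SL}_2(\mathbb{Z})$ are: for all $\left(\begin{smallmatrix}a&b\\c&d\end{smallmatrix}\right)\in\mathrm{SL}_2(\mathbb{Z})$ and $\lambda,\mu\in\mathbb{Z}$, (1) $\phi\left(\frac{z}{c\tau+d};\frac{a\tau+b}{c\tau+d}\right)=(c\tau+d)^k e^{\frac{2\pi i m c z^2}{c\tau+d}}\phi(z;\tau)$; (2) $\phi(z+\lambda\tau+\mu;\tau)=e^{-2\pi i m(\lambda^2\tau+2\lambda z)}\phi(z;\tau)$. The coefficients $\chi_n$ are also allowed to be non-holomorphic in $\tau$.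
   Formalization: The expansion is taken near z=0 with each χ_n(·;τ) holomorphic near 0 (so antiholomorphic in z), finitely many negative n, and locally uniform convergence on a punctured disc; for arbitrary χ_n the expansion does not determine χ_n(0;τ) and the claim fails. *)

theory Defs
  imports "HOL-Complex_Analysis.Complex_Analysis"
begin

text \<open>
  Functions on \<open>\<complex> \<times> \<H>\<close> (resp. on \<open>\<H>\<close>) are total functions of type
  \<open>complex \<Rightarrow> complex \<Rightarrow> complex\<close> (resp. \<open>complex \<Rightarrow> complex\<close>) whose
  values are only constrained for \<open>\<tau> \<in> \<H>\<close>.
\<close>

definition upper_half_plane :: "complex set" where
  "upper_half_plane = {\<tau>. Im \<tau> > 0}"

definition jacobi_transformation_laws ::
    "nat \<Rightarrow> nat \<Rightarrow> (complex \<Rightarrow> complex \<Rightarrow> complex) \<Rightarrow> bool" where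
  "jacobi_transformation_laws k m \<phi> \<longleftrightarrow>
     (\<forall>z. \<forall>\<tau>\<in>upper_half_plane. \<forall>a b c d :: int. a * d - b * c = 1 \<longrightarrow>
        \<phi> (z / (of_int c * \<tau> + of_int d))
          ((of_int a * \<tau> + of_int b) / (of_int c * \<tau> + of_int d)) =
        (of_int c * \<tau> + of_int d) ^ k *
        exp (2 * of_real pi * \<i> * of_nat m * of_int c * z\<^sup>2 / (of_int c * \<tau> + of_int d)) *
        \<phi> z \<tau>) \<and>
     (\<forall>z. \<forall>\<tau>\<in>upper_half_plane. \<forall>l \<mu> :: int.
        \<phi> (z + of_int l * \<tau> + of_int \<mu>) \<tau> =
        exp (- (2 * of_real pi * \<i> * of_nat m * ((of_int l)\<^sup>2 * \<tau> + 2 * of_int l * z))) *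
        \<phi> z \<tau>)"

definition transforms_like_modular_form :: "int \<Rightarrow> (complex \<Rightarrow> complex) \<Rightarrow> bool" where
  "transforms_like_modular_form w f \<longleftrightarrow>
     (\<forall>\<tau>\<in>upper_half_plane. \<forall>a b c d :: int. a * d - b * c = 1 \<longrightarrow>
        f ((of_int a * \<tau> + of_int b) / (of_int c * \<tau> + of_int d)) =
        (of_int c * \<tau> + of_int d) powi w * f \<tau>)"

text \<open>
  The expansion \<open>\<phi>(z;\<tau>) = \<Sum>\<^sub>n X\<^sub>n(cnj z;\<tau>) z\<^sup>n\<close> about \<open>z = 0\<close>; the coefficient functions are
  called \<open>X\<close> because the letter chi is the vector binder of HOL-Analysis.  Writing the coefficients
  as functions of \<open>cnj z\<close> means that they are antiholomorphic in \<open>z\<close>, i.e. that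
  \<open>w \<mapsto> X\<^sub>n(w;\<tau>)\<close> is holomorphic near \<open>0\<close>; for arbitrary functions \<open>X\<^sub>n\<close> the
  expansion would not determine the values \<open>X\<^sub>n(0;\<tau>)\<close>.  Nothing is assumed about the
  dependence on \<open>\<tau>\<close>; in particular, the radius \<open>r\<close> and the lowest index \<open>N\<close>
  may vary with \<open>\<tau>\<close>.  Finitely many negative powers are allowed.  For this reason the series
  is required to converge (locally uniformly) on a punctured disc only; the
  Taylor case is \<open>N = 0\<close>, where a locally uniformly convergent expansion on a full disc is
  in particular of this form.
\<close>

definition has_z_expansion ::
    "(complex \<Rightarrow> complex \<Rightarrow> complex) \<Rightarrow> (int \<Rightarrow> complex \<Rightarrow> complex \<Rightarrow> complex) \<Rightarrow> bool" where
  "has_z_expansion \<phi> X \<longleftrightarrow>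
     (\<forall>\<tau>\<in>upper_half_plane. \<exists>r>0. \<exists>N :: int.
        (\<forall>n. (\<lambda>w. X n w \<tau>) holomorphic_on ball 0 r) \<and>
        (\<forall>n<N. \<forall>w\<in>ball 0 r. X n w \<tau> = 0) \<and>
        (\<forall>K. compact K \<and> K \<subseteq> ball 0 r - {0} \<longrightarrow>
           uniform_limit K (\<lambda>M z. \<Sum>n=N..M. X n (cnj z) \<tau> * z powi n) (\<lambda>z. \<phi> z \<tau>) at_top))"

text \<open>
  If \<open>has_z_expansion \<phi> X\<close> holds and \<open>\<tau> \<in> \<H>\<close>, only finitely many terms of this series are nonzero.
\<close>

definition psi_coeff ::
    "nat \<Rightarrow> (int \<Rightarrow> complex \<Rightarrow> complex \<Rightarrow> complex) \<Rightarrow> int \<Rightarrow> complex \<Rightarrow> complex" where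
  "psi_coeff m X n \<tau> =
     (\<Sum>j. of_real ((pi * real m / Im \<tau>) ^ j / fact j) * X (n - 2 * int j) 0 \<tau>)"

end

theory Submission
  imports Defs
begin

text \<open>
  Put \<open>\<alpha> = \<pi> m / Im \<tau>\<close>.  The elliptic factor \<open>exp (2 \<pi> i m c z\<^sup>2 / (c \<tau> + d))\<close> is exactly what
  \<open>exp (\<alpha> z\<^sup>2)\<close> loses under \<open>(z, \<tau>) \<mapsto> (z / (c \<tau> + d), (a \<tau> + b) / (c \<tau> + d))\<close>, so
  \<open>exp (\<alpha> z\<^sup>2) \<phi>(z; \<tau>)\<close> transforms with the factor \<open>(c \<tau> + d)\<^sup>k\<close> alone, and \<open>\<psi>\<^sub>n\<close> is its \<open>n\<close>-th
  coefficient at \<open>cnj z = 0\<close>.  This coefficient is determined by the function: it is the limit, as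
  \<open>\<rho> \<rightarrow> 0\<close>, of the mean over the circle \<open>|z| = \<rho>\<close> of the function divided by \<open>z\<^sup>n\<close>.  Terms with
  positive powers of \<open>cnj z\<close> in \<open>X\<^sub>n\<close> and all terms of lower index have mean zero, and the terms of
  higher index are negligible, because the maximum principle for \<open>w \<mapsto> X\<^sub>l(w; \<tau>)\<close> turns uniform
  convergence on one circle into geometric decay inside it.
\<close>

section \<open>Means over circles about 0, and remainder estimates near 0\<close>

text \<open>An average in the angle rather than a contour integral, because it commutes with
  conjugation. This makes functions of \<open>cnj z\<close> as accessible as holomorphic
  ones.\<close>

definition circle_mean :: "(complex \<Rightarrow> complex) \<Rightarrow> real \<Rightarrow> complex" where
  "circle_mean f \<rho> = integral {0..1} (\<lambda>t. f (circlepath 0 \<rho> t))"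

lemma circlepath_in_sphere: "\<rho> > 0 \<Longrightarrow> circlepath 0 \<rho> t \<in> sphere 0 \<rho>"
  by (simp add: circlepath norm_mult)

lemma continuous_on_compose_circlepath:
  assumes "\<rho> > 0" "continuous_on (sphere 0 \<rho>) f"
  shows "continuous_on {0..1} (\<lambda>t. f (circlepath 0 \<rho> t))"
  using assms circlepath_in_sphere
  by (intro continuous_on_compose2[OF assms(2), of _ "circlepath 0 \<rho>"])
     (auto simp: circlepath intro!: continuous_intros)

lemma integrable_compose_circlepath:
  fixes f :: "complex \<Rightarrow> complex"
  assumes "\<rho> > 0" "continuous_on (sphere 0 \<rho>) f"
  shows "(\<lambda>t. f (circlepath 0 \<rho> t)) integrable_on {0..1}"
  using continuous_on_compose_circlepath[OF assms] by (rule integrable_continuous_real)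

lemma circle_mean_cong:
  assumes "\<rho> > 0" "\<And>z. z \<in> sphere 0 \<rho> \<Longrightarrow> f z = g z"
  shows "circle_mean f \<rho> = circle_mean g \<rho>"
  unfolding circle_mean_def using assms circlepath_in_sphere by (intro integral_cong) auto

lemma circle_mean_add:
  assumes "\<rho> > 0" "continuous_on (sphere 0 \<rho>) f" "continuous_on (sphere 0 \<rho>) g"
  shows "circle_mean (\<lambda>z. f z + g z) \<rho> = circle_mean f \<rho> + circle_mean g \<rho>"
  unfolding circle_mean_def using assms
  by (intro integral_add integrable_compose_circlepath)

lemma circle_mean_cmult: "circle_mean (\<lambda>z. c * f z) \<rho> = c * circle_mean f \<rho>"
  unfolding circle_mean_def by simp

lemma circle_mean_sum:
  assumes "\<rho> > 0" "finite A" "\<And>i. i \<in> A \<Longrightarrow> continuous_on (sphere 0 \<rho>) (f i)"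
  shows "circle_mean (\<lambda>z. \<Sum>i\<in>A. f i z) \<rho> = (\<Sum>i\<in>A. circle_mean (f i) \<rho>)"
  unfolding circle_mean_def using assms
  by (intro integral_sum integrable_compose_circlepath)

lemma circle_mean_cnj: "circle_mean (\<lambda>z. cnj (f z)) \<rho> = cnj (circle_mean f \<rho>)"
  unfolding circle_mean_def by (simp add: integral_cnj)

lemma norm_circle_mean_le:
  assumes "\<rho> > 0" "continuous_on (sphere 0 \<rho>) f" "\<And>z. z \<in> sphere 0 \<rho> \<Longrightarrow> norm (f z) \<le> B"
  shows "norm (circle_mean f \<rho>) \<le> B"
proof -
  have "norm (circle_mean f \<rho>) \<le> B * (1 - 0)"
    unfolding circle_mean_def using assms circlepath_in_sphere
    by (intro integral_bound continuous_on_compose_circlepath) auto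
  then show ?thesis by simp
qed

text \<open>Cauchy's formula at the centre: the derivative of the circle path is
  \<open>2 * pi * \<i>\<close> times the point itself, which cancels the kernel
  \<open>1 / u\<close>.\<close>

lemma circle_mean_holomorphic:
  assumes "f holomorphic_on ball 0 r" "0 < \<rho>" "\<rho> < r"
  shows "circle_mean f \<rho> = f 0"
proof -
  have "((\<lambda>u. f u / (u - 0)) has_contour_integral 2 * of_real pi * \<i> * f 0) (circlepath 0 \<rho>)"
    using assms
    by (intro Cauchy_integral_circlepath holomorphic_on_imp_continuous_on
          holomorphic_on_subset[OF assms(1)]) auto
  then have "((\<lambda>t. f (circlepath 0 \<rho> t) / circlepath 0 \<rho> t * (2 * pi * \<i> * \<rho> * exp (2 * of_real pi * \<i> * t)))
      has_integral 2 * of_real pi * \<i> * f 0) {0..1}"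
    unfolding has_contour_integral_def
    by (rule has_integral_eq[rotated]) (simp add: vector_derivative_circlepath01)
  then have "((\<lambda>t. 2 * of_real pi * \<i> * f (circlepath 0 \<rho> t)) has_integral 2 * of_real pi * \<i> * f 0) {0..1}"
    by (rule has_integral_eq[rotated]) (use assms in \<open>simp add: circlepath\<close>)
  then have "2 * of_real pi * \<i> * circle_mean f \<rho> = 2 * of_real pi * \<i> * f 0"
    unfolding circle_mean_def by (simp flip: integral_mult_right add: integral_unique)
  then show ?thesis by simp
qed

lemma circle_mean_antiholomorphic:
  assumes "G holomorphic_on ball 0 r" "0 < \<rho>" "\<rho> < r"
  shows "circle_mean (\<lambda>z. G (cnj z) / z ^ p) \<rho> = (if p = 0 then G 0 else 0)"
proof -
  \<comment> \<open>On the circle \<open>1 / z = cnj z / \<rho>\<^sup>2\<close>, so the integrand is the conjugate of a holomorphic function.\<close>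
  define H where "H = (\<lambda>z. cnj (G (cnj z)) * z ^ p)"
  have "(cnj \<circ> G \<circ> cnj) holomorphic_on ball 0 r"
  proof (rule holomorphic_on_compose_cnj_cnj)
    have "cnj ` ball 0 r \<subseteq> ball 0 r" by auto
    then show "G holomorphic_on cnj ` ball 0 r" by (rule holomorphic_on_subset[OF assms(1)])
  qed auto
  then have "(\<lambda>z. cnj (G (cnj z))) holomorphic_on ball 0 r" by (simp add: o_def)
  then have H: "H holomorphic_on ball 0 r"
    unfolding H_def by (intro holomorphic_intros)
  have "circle_mean (\<lambda>z. G (cnj z) / z ^ p) \<rho> = circle_mean (\<lambda>z. of_real (inverse (\<rho> ^ (2 * p))) * cnj (H z)) \<rho>"
  proof (rule circle_mean_cong)
    fix z :: complex assume z: "z \<in> sphere 0 \<rho>"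
    then have "z * cnj z = of_real (\<rho>\<^sup>2)" using complex_norm_square[of z] by simp
    then have "of_real (\<rho> ^ (2 * p)) = z ^ p * cnj z ^ p"
      by (metis of_real_power power_mult power_mult_distrib)
    moreover have "z \<noteq> 0" using z assms by auto
    ultimately show "G (cnj z) / z ^ p = of_real (inverse (\<rho> ^ (2 * p))) * cnj (H z)"
      using assms(2) unfolding H_def of_real_inverse by (simp add: field_simps)
  qed fact
  also have "\<dots> = of_real (inverse (\<rho> ^ (2 * p))) * cnj (H 0)"
    unfolding circle_mean_cmult circle_mean_cnj using circle_mean_holomorphic[OF H assms(2,3)] by simp
  \<comment> \<open>\<open>H 0\<close> contains the factor \<open>0 ^ p\<close>, which is 1 for
    \<open>p = 0\<close> and 0 otherwise.\<close>
  also have "\<dots> = (if p = 0 then G 0 else 0)" by (simp add: H_def)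
  finally show ?thesis .
qed

text \<open>The mean is at most the supremum on the circle, and this is O(\<rho>). The lemma serves
  to discard remainders, which are controlled on a punctured disc only.\<close>

lemma circle_mean_tendsto_0:
  assumes "r > 0" "continuous_on (ball 0 r - {0}) f" "f \<in> O[at 0](\<lambda>z. z)"
  shows "(circle_mean f \<longlongrightarrow> 0) (at_right 0)"
proof -
  obtain C where C: "C > 0" "eventually (\<lambda>z. norm (f z) \<le> C * norm z) (at 0)"
    using landau_o.bigE[OF assms(3)] by blast
  then obtain d where d: "d > 0" "\<And>z. z \<noteq> 0 \<Longrightarrow> norm z < d \<Longrightarrow> norm (f z) \<le> C * norm z"
    unfolding eventually_at by auto
  have "eventually (\<lambda>\<rho>. \<rho> \<in> {0<..<min r d}) (at_right 0)"
    using d assms(1) by (intro eventually_at_right_real) auto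
  then have "eventually (\<lambda>\<rho>. norm (circle_mean f \<rho>) \<le> C * \<rho>) (at_right 0)"
  proof eventually_elim
    case (elim \<rho>)
    show ?case
      using elim d(2)
      by (intro norm_circle_mean_le continuous_on_subset[OF assms(2)]) force+
  qed
  moreover have "((\<lambda>\<rho>. C * \<rho>) \<longlongrightarrow> C * 0) (at_right 0)" by (intro tendsto_intros)
  ultimately show ?thesis by (auto intro: Lim_null_comparison)
qed

text \<open>The Taylor bound for exp at \<open>\<alpha> * z\<^sup>2\<close>. For
  \<open>norm z < 1\<close> its factor \<open>exp (norm (\<alpha> * z\<^sup>2))\<close> is at most
  \<open>exp (norm \<alpha>)\<close>, which gives the constant below.\<close>

lemma exp_square_remainder_bigo:
  "(\<lambda>z::complex. exp (\<alpha> * z\<^sup>2) - (\<Sum>j\<le>J. \<alpha> ^ j / fact j * z powi (2 * int j)))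
     \<in> O[at 0](\<lambda>z. z powi (2 * int (Suc J)))"
proof (rule bigoI[of _ "exp (norm \<alpha>) * norm \<alpha> ^ Suc J / fact J"])
  have "norm (exp (\<alpha> * z\<^sup>2) - (\<Sum>j\<le>J. \<alpha> ^ j / fact j * z powi (2 * int j)))
      \<le> exp (norm \<alpha>) * norm \<alpha> ^ Suc J / fact J * norm (z powi (2 * int (Suc J)))"
    if z: "norm z < 1" for z :: complex
  proof -
    have pw: "z powi (2 * int j) = (z\<^sup>2) ^ j" for j
      by (metis of_nat_mult of_nat_numeral power_int_of_nat power_mult)
    have "norm (\<alpha> * z\<^sup>2) \<le> norm \<alpha> * 1"
      unfolding norm_mult norm_power using z by (intro mult_left_mono power_le_one) auto
    moreover have "norm (exp (\<alpha> * z\<^sup>2) - (\<Sum>j\<le>J. (\<alpha> * z\<^sup>2) ^ j / fact j))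
        \<le> exp (norm (\<alpha> * z\<^sup>2)) * norm (\<alpha> * z\<^sup>2) ^ Suc J / fact J"
      by (rule Taylor_exp_field)
    ultimately have "norm (exp (\<alpha> * z\<^sup>2) - (\<Sum>j\<le>J. (\<alpha> * z\<^sup>2) ^ j / fact j))
        \<le> exp (norm \<alpha>) * norm (\<alpha> * z\<^sup>2) ^ Suc J / fact J"
      by (elim order.trans) (intro divide_right_mono mult_right_mono, auto)
    then show ?thesis unfolding pw
      by (simp add: norm_mult norm_power power_mult_distrib mult_ac del: power_Suc)
  qed
  then show "eventually (\<lambda>z::complex. norm (exp (\<alpha> * z\<^sup>2) - (\<Sum>j\<le>J. \<alpha> ^ j / fact j * z powi (2 * int j)))
      \<le> exp (norm \<alpha>) * norm \<alpha> ^ Suc J / fact J * norm (z powi (2 * int (Suc J)))) (at 0)"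
    by (auto simp: eventually_at intro!: exI[of _ 1])
qed

section \<open>Laurent expansions with antiholomorphic coefficients\<close>

text \<open>The content of \<open>has_z_expansion\<close> at one fixed \<tau>. It is used at \<tau>
  and, after rescaling the variable, at the image of \<tau>, each with its own radius and lowest
  index.\<close>

locale punctured_expansion =
  fixes f :: "complex \<Rightarrow> complex" and X :: "int \<Rightarrow> complex \<Rightarrow> complex" and r :: real and N :: int
  assumes r_pos: "r > 0"
    and holo: "\<And>l. X l holomorphic_on ball 0 r"
    and vanish: "\<And>l w. l < N \<Longrightarrow> w \<in> ball 0 r \<Longrightarrow> X l w = 0"
    and unif: "\<And>K. compact K \<Longrightarrow> K \<subseteq> ball 0 r - {0} \<Longrightarrow>
      uniform_limit K (\<lambda>M z. \<Sum>l=N..M. X l (cnj z) * z powi l) f at_top"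
begin

lemma continuous_term: "continuous_on (ball 0 r - {0}) (\<lambda>z. X l (cnj z) * z powi p)"
proof -
  have "continuous_on (ball 0 r) (X l)"
    by (rule holomorphic_on_imp_continuous_on[OF holo])
  then have "continuous_on (ball 0 r - {0}) (\<lambda>z. X l (cnj z))"
    by (rule continuous_on_compose2) (auto intro!: continuous_intros)
  then show ?thesis by (intro continuous_intros) auto
qed

lemma continuous: "continuous_on (ball 0 r - {0}) f"
proof -
  have op: "open (ball 0 r - {0::complex})" by auto
  have "isCont f z" if z: "z \<in> ball 0 r - {0}" for z
  proof -
    obtain e where e: "e > 0" "cball z e \<subseteq> ball 0 r - {0}"
      using op z open_contains_cball by blast
    have "continuous_on (cball z e) f"
      by (rule uniform_limit_theorem[OF _ unif])
         (use e in \<open>auto intro!: always_eventually continuous_on_sum continuous_on_subset[OF continuous_term]\<close>)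
    then show ?thesis using e(1)
      by (meson ball_subset_cball centre_in_ball continuous_on_eq_continuous_at continuous_on_subset open_ball)
  qed
  then show ?thesis by (simp add: continuous_at_imp_continuous_on)
qed

text \<open>On the circle of radius \<rho> the terms of the series are bounded uniformly in
  \<open>l\<close>: uniform convergence handles large \<open>l\<close>, compactness the finitely
  many others. Dividing by \<open>\<rho> powi l\<close> bounds \<open>X l\<close> on the circle, and
  the maximum principle carries the bound to the disc.\<close>

lemma coeff_bound:
  assumes \<rho>: "0 < \<rho>" "\<rho> < r"
  obtains C where "C > 0" "\<And>l w. w \<in> cball 0 \<rho> \<Longrightarrow> norm (X l w) \<le> C * \<rho> powi (-l)"
proof -
  define T where "T = (\<lambda>l z. X l (cnj z) * z powi l)"
  define S where "S = (\<lambda>M z. \<Sum>l=N..M. T l z)"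
  have sub: "sphere 0 \<rho> \<subseteq> ball 0 r - {0::complex}" using \<rho> by auto
  have "uniform_limit (sphere 0 \<rho>) S f at_top"
    unfolding S_def T_def using sub by (intro unif) auto
  then have "eventually (\<lambda>M. \<forall>z\<in>sphere 0 \<rho>. dist (S M z) (f z) < 1) at_top"
    by (rule uniform_limitD) simp
  then obtain M0 where M0: "\<And>M z. M \<ge> M0 \<Longrightarrow> z \<in> sphere 0 \<rho> \<Longrightarrow> dist (S M z) (f z) < 1"
    unfolding eventually_at_top_linorder by blast
  \<comment> \<open>A late term is the difference of two consecutive partial sums, each within 1 of
    \<open>f z\<close>.\<close>
  have tail: "norm (T l z) \<le> 2" if "l > M0" "l \<ge> N" "z \<in> sphere 0 \<rho>" for l z
  proof -
    have "{N..l} = insert l {N..l - 1}" using that by auto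
    then have "T l z = S l z - S (l - 1) z" unfolding S_def by simp
    moreover have "dist (S l z) (S (l - 1) z) < 1 + 1"
      using M0[of l z] M0[of "l - 1" z] that dist_triangle_lt[of "S l z" "f z" "S (l-1) z" 2]
        dist_triangle_half_r[of "f z" "S l z" 2 "S (l-1) z"] by (auto simp: dist_commute)
    ultimately show ?thesis by (simp add: dist_norm)
  qed
  have "\<exists>B. \<forall>z\<in>sphere 0 \<rho>. norm (T l z) \<le> B" for l
  proof -
    have "compact (T l ` sphere 0 \<rho>)"
      unfolding T_def by (intro compact_continuous_image continuous_on_subset[OF continuous_term sub]) auto
    then show ?thesis using compact_imp_bounded bounded_iff by (metis imageI)
  qed
  then obtain B where B: "\<And>l z. z \<in> sphere 0 \<rho> \<Longrightarrow> norm (T l z) \<le> B l" by metis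
  define C where "C = 2 + (\<Sum>l=N..M0. \<bar>B l\<bar>)"
  have Cpos: "C > 0" unfolding C_def by (simp add: sum_nonneg add_pos_nonneg)
  have bound: "norm (T l z) \<le> C" if z: "z \<in> sphere 0 \<rho>" and l: "l \<ge> N" for l z
  proof (cases "l > M0")
    case True
    then show ?thesis using tail[OF True l z] unfolding C_def
      by (smt (verit) sum_nonneg abs_ge_zero)
  next
    case False
    then have "\<bar>B l\<bar> \<le> (\<Sum>l=N..M0. \<bar>B l\<bar>)" using l by (intro member_le_sum) auto
    then show ?thesis using B[OF z, of l] unfolding C_def by linarith
  qed
  have "norm (X l w) \<le> C * \<rho> powi (-l)" if w: "w \<in> cball 0 \<rho>" for l w
  proof (cases "l < N")
    case True
    then show ?thesis using vanish[of l w] w \<rho> Cpos by simp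
  next
    case False
    show ?thesis
    proof (rule maximum_modulus_frontier[of "X l" "cball 0 \<rho>"])
      show "X l holomorphic_on interior (cball 0 \<rho>)"
        using \<rho> by (intro holomorphic_on_subset[OF holo]) auto
      show "continuous_on (closure (cball 0 \<rho>)) (X l)"
        using \<rho> by (intro holomorphic_on_imp_continuous_on holomorphic_on_subset[OF holo]) auto
      fix z assume "z \<in> frontier (cball (0::complex) \<rho>)"
      then have z: "cmod z = \<rho>" using \<rho> by simp
      \<comment> \<open>Conjugation preserves the circle, so evaluating at \<open>cnj z\<close>
        turns the bound for \<open>X l (cnj z)\<close> into one for \<open>X l z\<close>.\<close>
      then have "norm (T l (cnj z)) \<le> C" using False by (intro bound) auto
      then have "norm (X l z) * \<rho> powi l \<le> C"
        using z by (simp add: T_def norm_mult norm_power_int)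
      then show "norm (X l z) \<le> C * \<rho> powi (-l)"
        using \<rho> by (simp add: power_int_minus field_simps)
    qed (use w in auto)
  qed
  with Cpos that show ?thesis by blast
qed

text \<open>Uniform convergence by itself gives no order of vanishing at 0; the bound on the
  coefficients does, by comparing the tail with a geometric series in
  \<open>norm z / \<rho>\<close>.\<close>

lemma remainder_bigo:
  "(\<lambda>z. f z - (\<Sum>l=N..M. X l (cnj z) * z powi l)) \<in> O[at 0](\<lambda>z. z powi (M + 1))"
proof -
  define \<rho> where "\<rho> = r / 2"
  have \<rho>: "0 < \<rho>" "\<rho> < r" using r_pos unfolding \<rho>_def by auto
  obtain C where C: "C > 0" "\<And>l w. w \<in> cball 0 \<rho> \<Longrightarrow> norm (X l w) \<le> C * \<rho> powi (-l)"
    using coeff_bound[OF \<rho>] by blast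
  \<comment> \<open>For \<open>norm z < \<rho> / 2\<close> the ratio is at most 1/2, so the
    geometric series contributes the factor 2; the power of \<rho> comes from
    \<open>(norm z / \<rho>) powi (M + 1)\<close>.\<close>
  have *: "norm (f z - (\<Sum>l=N..M. X l (cnj z) * z powi l)) \<le> 2 * C * \<rho> powi (-(M+1)) * norm (z powi (M + 1))"
    if z: "z \<noteq> 0" "norm z < \<rho> / 2" for z
  proof -
    define q where "q = norm z / \<rho>"
    have q: "0 < q" "q \<le> 1 / 2" using z \<rho> unfolding q_def by (auto simp: field_simps)
    have term_le: "norm (X l (cnj z) * z powi l) \<le> C * q powi l" for l
    proof -
      have "norm (X l (cnj z) * z powi l) \<le> C * \<rho> powi (-l) * norm z powi l"
        unfolding norm_mult norm_power_int using z \<rho> by (intro mult_right_mono C(2)) auto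
      then show ?thesis
        unfolding q_def by (simp add: power_int_divide_distrib power_int_minus field_simps)
    qed
    have part: "norm (\<Sum>l=M+1..M'. X l (cnj z) * z powi l) \<le> 2 * C * q powi (M + 1)" for M'
    proof -
      have "norm (\<Sum>l=M+1..M'. X l (cnj z) * z powi l) \<le> (\<Sum>l=M+1..M'. C * q powi l)"
        by (intro sum_norm_le term_le)
      also have "\<dots> = (\<Sum>i<nat (M' - M). C * q powi (M + 1) * q ^ i)"
        by (rule sum.reindex_bij_witness[of _ "\<lambda>i. M + 1 + int i" "\<lambda>l. nat (l - (M + 1))"])
           (use q in \<open>auto simp: field_simps simp flip: power_int_of_nat power_int_add\<close>)
      also have "\<dots> = C * q powi (M + 1) * (\<Sum>i<nat (M' - M). q ^ i)"
        by (simp add: sum_distrib_left)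
      also have "\<dots> \<le> C * q powi (M + 1) * 2"
      proof (intro mult_left_mono)
        have "(\<Sum>i<nat (M' - M). q ^ i) \<le> (\<Sum>i. q ^ i)"
          using q by (intro sum_le_suminf summable_geometric) auto
        also have "\<dots> = 1 / (1 - q)" using q by (intro suminf_geometric) auto
        also have "\<dots> \<le> 2" using q by (simp add: field_simps)
        finally show "(\<Sum>i<nat (M' - M). q ^ i) \<le> 2" .
      qed (use C q in auto)
      finally show ?thesis by (simp add: mult_ac)
    qed
    have "uniform_limit {z} (\<lambda>M z. \<Sum>l=N..M. X l (cnj z) * z powi l) f at_top"
      using z \<rho> by (intro unif) auto
    then have "((\<lambda>M. \<Sum>l=N..M. X l (cnj z) * z powi l) \<longlongrightarrow> f z) at_top"
      by (rule tendsto_uniform_limitI) auto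
    then have "((\<lambda>M'. norm ((\<Sum>l=N..M'. X l (cnj z) * z powi l) - (\<Sum>l=N..M. X l (cnj z) * z powi l)))
        \<longlongrightarrow> norm (f z - (\<Sum>l=N..M. X l (cnj z) * z powi l))) at_top"
      by (intro tendsto_intros)
    moreover have "eventually (\<lambda>M'. norm ((\<Sum>l=N..M'. X l (cnj z) * z powi l) - (\<Sum>l=N..M. X l (cnj z) * z powi l))
        \<le> 2 * C * q powi (M + 1)) at_top"
      using eventually_ge_at_top[of "max N M"]
    proof eventually_elim
      case (elim M')
      have "(\<Sum>l=N..M'. X l (cnj z) * z powi l) - (\<Sum>l=N..M. X l (cnj z) * z powi l)
          = (\<Sum>l\<in>{N..M'} - {N..M}. X l (cnj z) * z powi l)"
        using elim by (intro sum_diff[symmetric]) auto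
      \<comment> \<open>If \<open>M + 1 < N\<close>, the new range also contains indices below
        \<open>N\<close>, whose terms vanish.\<close>
      also have "\<dots> = (\<Sum>l=M+1..M'. X l (cnj z) * z powi l)"
      proof (rule sum.mono_neutral_left)
        show "\<forall>l\<in>{M + 1..M'} - ({N..M'} - {N..M}). X l (cnj z) * z powi l = 0"
        proof
          fix l assume "l \<in> {M + 1..M'} - ({N..M'} - {N..M})"
          then have "l < N" by auto
          then show "X l (cnj z) * z powi l = 0" using vanish[of l "cnj z"] z \<rho> by simp
        qed
      qed (use elim in auto)
      finally show ?case using part by simp
    qed
    ultimately have "norm (f z - (\<Sum>l=N..M. X l (cnj z) * z powi l)) \<le> 2 * C * q powi (M + 1)"
      by (rule tendsto_upperbound) simp
    then show ?thesis unfolding q_def norm_power_int power_int_divide_distrib power_int_minus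
      by (simp add: field_simps)
  qed
  show ?thesis
    by (rule bigoI[of _ "2 * C * \<rho> powi (-(M+1))"]) 
       (use * \<rho> in \<open>auto simp: eventually_at intro!: exI[of _ "\<rho> / 2"]\<close>)
qed

lemma bigo: "f \<in> O[at 0](\<lambda>z. z powi N)"
  \<comment> \<open>For \<open>M = N - 1\<close> the subtracted sum is empty.\<close>
  using remainder_bigo[of "N - 1"] by simp

text \<open>At a fixed radius the mean need not equal \<open>X n 0\<close>: a term
  \<open>cnj z ^ p * z powi (n + int p)\<close> with \<open>p > 0\<close> contributes
  \<open>\<rho> ^ (2 * p)\<close>. Such contributions disappear only in the limit.\<close>

lemma circle_mean_tendsto_coeff:
  "((\<lambda>\<rho>. circle_mean (\<lambda>z. f z * z powi (-n)) \<rho>) \<longlongrightarrow> X n 0) (at_right 0)"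
proof -
  \<comment> \<open>Cutting after index \<open>n\<close> leaves a remainder that is still O(z) after
    multiplication by \<open>z powi (-n)\<close>.\<close>
  define R where "R = (\<lambda>z. f z - (\<Sum>l=N..n. X l (cnj z) * z powi l))"
  have contR: "continuous_on (ball 0 r - {0}) R"
    unfolding R_def by (intro continuous_intros continuous continuous_term)
  have "(\<lambda>z. R z * z powi (-n)) \<in> O[at 0](\<lambda>z. z powi (n + 1) * z powi (-n))"
    unfolding R_def by (intro landau_o.big.mult remainder_bigo) auto
  also have "(\<lambda>z. z powi (n + 1) * z powi (-n)) \<in> \<Theta>[at 0](\<lambda>z::complex. z)"
    by (intro bigthetaI_cong) (auto simp: eventually_at power_int_add power_int_minus intro!: exI[of _ 1])
  finally have R0: "((\<lambda>\<rho>. circle_mean (\<lambda>z. R z * z powi (-n)) \<rho>) \<longlongrightarrow> 0) (at_right 0)"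
    by (intro circle_mean_tendsto_0[OF r_pos] continuous_intros contR) auto
  have "eventually (\<lambda>\<rho>. \<rho> \<in> {0<..<r}) (at_right 0)"
    using r_pos by (intro eventually_at_right_real)
  then have "eventually (\<lambda>\<rho>. circle_mean (\<lambda>z. R z * z powi (-n)) \<rho> + X n 0 = 
       circle_mean (\<lambda>z. f z * z powi (-n)) \<rho>) (at_right 0)"
  proof eventually_elim
    case (elim \<rho>)
    then have \<rho>: "0 < \<rho>" "\<rho> < r" by auto
    have sub: "sphere 0 \<rho> \<subseteq> ball 0 r - {0::complex}" using \<rho> by auto
    have "circle_mean (\<lambda>z. f z * z powi (-n)) \<rho> =
        circle_mean (\<lambda>z. R z * z powi (-n) + (\<Sum>l=N..n. X l (cnj z) * z powi (l - n))) \<rho>"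
    proof (rule circle_mean_cong)
      fix z :: complex assume "z \<in> sphere 0 \<rho>"
      then have "z \<noteq> 0" using \<rho> by auto
      then have "(\<Sum>l=N..n. X l (cnj z) * z powi (l - n)) = (\<Sum>l=N..n. X l (cnj z) * z powi l) * z powi (-n)"
        unfolding sum_distrib_right
        by (intro sum.cong) (simp_all add: power_int_diff power_int_minus field_simps)
      then show "f z * z powi (-n) = R z * z powi (-n) + (\<Sum>l=N..n. X l (cnj z) * z powi (l - n))"
        unfolding R_def by (simp add: algebra_simps)
    qed fact
    also have "\<dots> = circle_mean (\<lambda>z. R z * z powi (-n)) \<rho> +
        circle_mean (\<lambda>z. \<Sum>l=N..n. X l (cnj z) * z powi (l - n)) \<rho>"
    proof (intro circle_mean_add \<rho> continuous_on_sum continuous_on_subset[OF continuous_term sub])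
      show "continuous_on (sphere 0 \<rho>) (\<lambda>z. R z * z powi (-n))"
        using sub by (intro continuous_intros continuous_on_subset[OF contR]) auto
    qed
    also have "circle_mean (\<lambda>z. \<Sum>l=N..n. X l (cnj z) * z powi (l - n)) \<rho> =
        (\<Sum>l=N..n. circle_mean (\<lambda>z. X l (cnj z) * z powi (l - n)) \<rho>)"
      using \<rho> by (intro circle_mean_sum continuous_on_subset[OF continuous_term sub]) auto
    \<comment> \<open>For \<open>l \<le> n\<close> the exponent \<open>l - n\<close> is not
      positive, so the mean of an antiholomorphic function over a power of \<open>z\<close> applies
      and only \<open>l = n\<close> survives.\<close>
    also have "\<dots> = (\<Sum>l=N..n. if l = n then X n 0 else 0)"
    proof (rule sum.cong)
      fix l assume l: "l \<in> {N..n}"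
      then have "circle_mean (\<lambda>z. X l (cnj z) * z powi (l - n)) \<rho> =
          circle_mean (\<lambda>z. X l (cnj z) / z ^ nat (n - l)) \<rho>"
        by (intro arg_cong2[where f = circle_mean] ext)
           (auto simp: power_int_def field_simps)
      then show "circle_mean (\<lambda>z. X l (cnj z) * z powi (l - n)) \<rho> = (if l = n then X n 0 else 0)"
        using circle_mean_antiholomorphic[OF holo \<rho>, of l "nat (n - l)"] l by auto
    qed simp
    \<comment> \<open>If \<open>n < N\<close>, the sum is empty and \<open>X n 0\<close> vanishes as
      well.\<close>
    also have "\<dots> = X n 0" using vanish[of n 0] r_pos by (auto simp: not_le)
    finally show ?case by simp
  qed
  moreover have "((\<lambda>\<rho>. circle_mean (\<lambda>z. R z * z powi (-n)) \<rho> + X n 0) \<longlongrightarrow> 0 + X n 0) (at_right 0)"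
    by (intro tendsto_intros R0)
  ultimately show ?thesis using Lim_transform_eventually by fastforce
qed

text \<open>The factor \<open>z powi (2 * int j)\<close> moves the coefficient of index
  \<open>n - 2 * int j\<close> to index \<open>n\<close>. Arguing with means for finitely many
  \<open>j\<close> avoids rearranging the product of two infinite series.\<close>

lemma circle_mean_exp_tendsto:
  "((\<lambda>\<rho>. circle_mean (\<lambda>z. exp (\<alpha> * z\<^sup>2) * f z * z powi (-n)) \<rho>)
     \<longlongrightarrow> (\<Sum>j. \<alpha> ^ j / fact j * X (n - 2 * int j) 0)) (at_right 0)"
proof -
  \<comment> \<open>The exponential series is cut off where \<open>z\<^bsup>2j\<^esup> f z = O(z\<^bsup>2j + N\<^esup>)\<close> no longer contributes to the \<open>n\<close>-th coefficient.\<close>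
  define J where "J = nat (n - N)"
  have J: "2 * int (Suc J) + N - n \<ge> 1" unfolding J_def by auto
  define R where "R = (\<lambda>z. exp (\<alpha> * z\<^sup>2) - (\<Sum>j\<le>J. \<alpha> ^ j / fact j * z powi (2 * int j)))"
  have contR: "continuous_on (ball 0 r - {0}) R"
    unfolding R_def by (intro continuous_intros) auto
  have "(\<lambda>z. R z * f z * z powi (-n)) \<in> O[at 0](\<lambda>z. z powi (2 * int (Suc J)) * z powi N * z powi (-n))"
    unfolding R_def by (intro landau_o.big.mult exp_square_remainder_bigo bigo) auto
  also have "(\<lambda>z::complex. z powi (2 * int (Suc J)) * z powi N * z powi (-n)) \<in> O[at 0](\<lambda>z. z)"
  proof (rule bigoI[of _ 1])
    have "norm (z powi (2 * int (Suc J)) * z powi N * z powi (-n)) \<le> 1 * norm z"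
      if "z \<noteq> 0" "norm z < 1" for z :: complex
    proof -
      have "norm (z powi (2 * int (Suc J)) * z powi N * z powi (-n)) = norm z powi (2 * int (Suc J) + N - n)"
        using that by (simp add: norm_mult norm_power_int power_int_add power_int_diff power_int_minus
          norm_inverse divide_inverse del: of_nat_Suc)
      also have "\<dots> \<le> norm z powi 1"
        using J that by (intro power_int_decreasing) auto
      finally show ?thesis by simp
    qed
    then show "eventually (\<lambda>z::complex. norm (z powi (2 * int (Suc J)) * z powi N * z powi (-n)) \<le> 1 * norm z) (at 0)"
      by (auto simp: eventually_at intro!: exI[of _ 1])
  qed
  finally have R0: "((\<lambda>\<rho>. circle_mean (\<lambda>z. R z * f z * z powi (-n)) \<rho>) \<longlongrightarrow> 0) (at_right 0)"
    by (intro circle_mean_tendsto_0[OF r_pos] continuous_intros contR continuous) auto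
  have "eventually (\<lambda>\<rho>. \<rho> \<in> {0<..<r}) (at_right 0)"
    using r_pos by (intro eventually_at_right_real)
  then have "eventually (\<lambda>\<rho>. circle_mean (\<lambda>z. R z * f z * z powi (-n)) \<rho>
        + (\<Sum>j\<le>J. \<alpha> ^ j / fact j * circle_mean (\<lambda>z. f z * z powi (-(n - 2 * int j))) \<rho>)
      = circle_mean (\<lambda>z. exp (\<alpha> * z\<^sup>2) * f z * z powi (-n)) \<rho>) (at_right 0)"
  proof eventually_elim
    case (elim \<rho>)
    then have \<rho>: "0 < \<rho>" "\<rho> < r" by auto
    have sub: "sphere 0 \<rho> \<subseteq> ball 0 r - {0::complex}" using \<rho> by auto
    have cont: "continuous_on (sphere 0 \<rho>) (\<lambda>z. f z * z powi p)" for p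
      using sub by (intro continuous_intros continuous_on_subset[OF continuous]) auto
    have "circle_mean (\<lambda>z. exp (\<alpha> * z\<^sup>2) * f z * z powi (-n)) \<rho> =
        circle_mean (\<lambda>z. R z * f z * z powi (-n) +
          (\<Sum>j\<le>J. \<alpha> ^ j / fact j * (f z * z powi (-(n - 2 * int j))))) \<rho>"
    proof (rule circle_mean_cong)
      fix z :: complex assume "z \<in> sphere 0 \<rho>"
      then have "z \<noteq> 0" using \<rho> by auto
      then have "(\<Sum>j\<le>J. \<alpha> ^ j / fact j * (f z * z powi (-(n - 2 * int j)))) =
          (\<Sum>j\<le>J. \<alpha> ^ j / fact j * z powi (2 * int j)) * f z * z powi (-n)"
        unfolding sum_distrib_right
        by (intro sum.cong) (simp_all add: power_int_diff power_int_minus field_simps)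
      then show "exp (\<alpha> * z\<^sup>2) * f z * z powi (-n) = R z * f z * z powi (-n) +
          (\<Sum>j\<le>J. \<alpha> ^ j / fact j * (f z * z powi (-(n - 2 * int j))))"
        unfolding R_def by (simp add: algebra_simps)
    qed fact
    also have "\<dots> = circle_mean (\<lambda>z. R z * f z * z powi (-n)) \<rho> +
        circle_mean (\<lambda>z. \<Sum>j\<le>J. \<alpha> ^ j / fact j * (f z * z powi (-(n - 2 * int j)))) \<rho>"
    proof (intro circle_mean_add \<rho> continuous_on_sum continuous_on_mult_left cont)
      show "continuous_on (sphere 0 \<rho>) (\<lambda>z. R z * f z * z powi (-n))"
        using sub by (intro continuous_intros continuous_on_subset[OF contR] continuous_on_subset[OF continuous]) auto
    qed
    also have "circle_mean (\<lambda>z. \<Sum>j\<le>J. \<alpha> ^ j / fact j * (f z * z powi (-(n - 2 * int j)))) \<rho> =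
        (\<Sum>j\<le>J. \<alpha> ^ j / fact j * circle_mean (\<lambda>z. f z * z powi (-(n - 2 * int j))) \<rho>)"
      unfolding circle_mean_cmult[symmetric]
      using \<rho> by (intro circle_mean_sum continuous_on_mult_left cont) auto
    finally show ?case by simp
  qed
  moreover have "((\<lambda>\<rho>. circle_mean (\<lambda>z. R z * f z * z powi (-n)) \<rho>
        + (\<Sum>j\<le>J. \<alpha> ^ j / fact j * circle_mean (\<lambda>z. f z * z powi (-(n - 2 * int j))) \<rho>))
      \<longlongrightarrow> 0 + (\<Sum>j\<le>J. \<alpha> ^ j / fact j * X (n - 2 * int j) 0)) (at_right 0)"
    by (intro tendsto_intros R0 circle_mean_tendsto_coeff)
  \<comment> \<open>For \<open>j > J\<close> the index \<open>n - 2 * int j\<close> lies below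
    \<open>N\<close>.\<close>
  moreover have "(\<Sum>j. \<alpha> ^ j / fact j * X (n - 2 * int j) 0) = (\<Sum>j\<le>J. \<alpha> ^ j / fact j * X (n - 2 * int j) 0)"
    using vanish[of _ 0] r_pos by (intro suminf_finite) (auto simp: J_def)
  ultimately show ?thesis using Lim_transform_eventually by fastforce
qed

text \<open>Since \<open>cnj (z / J) = cnj z / cnj J\<close>, the scalar enters the coefficients
  conjugated and they stay holomorphic in \<open>w\<close>. This expands the function at the
  transformed point in the original variable \<open>z\<close>, so that both sides can be averaged
  over the same circle.\<close>

lemma rescale:
  assumes "J \<noteq> 0"
  shows "punctured_expansion (\<lambda>z. f (z / J)) (\<lambda>l w. X l (w / cnj J) * J powi (-l)) (r * norm J) N"
proof
  show "r * norm J > 0" using r_pos assms by simp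
  have div: "w / c \<in> ball 0 r" if "w \<in> ball 0 (r * norm J)" "norm c = norm J" for w c :: complex
    using that assms by (simp add: norm_divide field_simps)
  show "(\<lambda>w. X l (w / cnj J) * J powi (-l)) holomorphic_on ball 0 (r * norm J)" for l
  proof -
    have "(X l \<circ> (\<lambda>w. w / cnj J)) holomorphic_on ball 0 (r * norm J)"
      by (rule holomorphic_on_compose_gen[OF _ holo])
         (use div[of _ "cnj J"] assms in \<open>auto intro!: holomorphic_intros\<close>)
    then show ?thesis unfolding o_def by (intro holomorphic_intros)
  qed
  show "X l (w / cnj J) * J powi (-l) = 0" if "l < N" "w \<in> ball 0 (r * norm J)" for l w
    using vanish[OF that(1) div[OF that(2)], of "cnj J"] by simp
  fix K :: "complex set" assume K: "compact K" "K \<subseteq> ball 0 (r * norm J) - {0}"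
  have "uniform_limit ((\<lambda>z. z / J) ` K) (\<lambda>M z. \<Sum>l=N..M. X l (cnj z) * z powi l) f at_top"
    using K div[of _ J] assms by (intro unif compact_continuous_image continuous_intros) auto
  then have "uniform_limit K (\<lambda>M z. \<Sum>l=N..M. X l (cnj (z / J)) * (z / J) powi l) (\<lambda>z. f (z / J)) at_top"
    by (rule uniform_limit_compose') auto
  then show "uniform_limit K (\<lambda>M z. \<Sum>l=N..M. X l (cnj z / cnj J) * J powi (-l) * z powi l) (\<lambda>z. f (z / J)) at_top"
    by (simp add: power_int_divide_distrib power_int_minus field_simps)
qed

end

section \<open>Modular substitutions and the comparison of coefficients\<close>

lemma has_z_expansionE:
  assumes "has_z_expansion \<phi> X" "Im \<tau> > 0"
  obtains r N where "punctured_expansion (\<lambda>z. \<phi> z \<tau>) (\<lambda>l w. X l w \<tau>) r N"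
proof -
  have "\<exists>r>0. \<exists>N.
      (\<forall>l. (\<lambda>w. X l w \<tau>) holomorphic_on ball 0 r) \<and>
      (\<forall>l<N. \<forall>w\<in>ball 0 r. X l w \<tau> = 0) \<and>
      (\<forall>K. compact K \<and> K \<subseteq> ball 0 r - {0} \<longrightarrow>
        uniform_limit K (\<lambda>M z. \<Sum>l=N..M. X l (cnj z) \<tau> * z powi l) (\<lambda>z. \<phi> z \<tau>) at_top)"
    using assms by (simp add: has_z_expansion_def upper_half_plane_def)
  then obtain r N where "r > 0"
      "\<forall>l. (\<lambda>w. X l w \<tau>) holomorphic_on ball 0 r"
      "\<forall>l<N. \<forall>w\<in>ball 0 r. X l w \<tau> = 0"
      "\<forall>K. compact K \<and> K \<subseteq> ball 0 r - {0} \<longrightarrow>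
        uniform_limit K (\<lambda>M z. \<Sum>l=N..M. X l (cnj z) \<tau> * z powi l) (\<lambda>z. \<phi> z \<tau>) at_top"
    by (elim exE conjE)
  then have "punctured_expansion (\<lambda>z. \<phi> z \<tau>) (\<lambda>l w. X l w \<tau>) r N"
    by unfold_locales simp_all
  then show thesis by (rule that)
qed

lemma Im_moebius:
  fixes a b c d :: int
  assumes "a * d - b * c = 1" "of_int c * \<tau> + of_int d \<noteq> 0"
  shows "Im ((of_int a * \<tau> + of_int b) / (of_int c * \<tau> + of_int d)) =
    Im \<tau> / (norm (of_int c * \<tau> + of_int d))\<^sup>2"
proof -
  have "real_of_int a * d - b * c = 1" using assms(1) by (metis of_int_1 of_int_diff of_int_mult)
  moreover have "Im ((of_int a * \<tau> + of_int b) * cnj (of_int c * \<tau> + of_int d)) =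
      (real_of_int a * d - b * c) * Im \<tau>"
    by (simp add: algebra_simps)
  ultimately have "Im ((of_int a * \<tau> + of_int b) * cnj (of_int c * \<tau> + of_int d)) = Im \<tau>"
    by simp
  then show ?thesis by (subst complex_div_cnj) simp
qed

theorem proposition3p1:
  fixes \<phi> :: "complex \<Rightarrow> complex \<Rightarrow> complex"
    and X :: "int \<Rightarrow> complex \<Rightarrow> complex \<Rightarrow> complex"
    and k m :: nat and n :: int
  assumes "jacobi_transformation_laws k m \<phi>"
    and "has_z_expansion \<phi> X"
  shows "transforms_like_modular_form (int k + n) (psi_coeff m X n)"
  unfolding transforms_like_modular_form_def
proof (intro ballI allI impI)
  fix \<tau> :: complex and a b c d :: int
  assume \<tau>: "\<tau> \<in> upper_half_plane" and det: "a * d - b * c = 1"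
  then have v: "Im \<tau> > 0" by (simp add: upper_half_plane_def)
  define J where "J = of_int c * \<tau> + of_int d"
  define \<tau>' where "\<tau>' = (of_int a * \<tau> + of_int b) / J"
  \<comment> \<open>The imaginary part of \<open>J\<close> is \<open>c * Im \<tau>\<close>, so
    \<open>J = 0\<close> forces \<open>c = 0\<close>, then \<open>d = 0\<close>, against determinant
    1.\<close>
  have J: "J \<noteq> 0"
  proof
    assume "J = 0"
    then have "c = 0" "d = 0 \<or> c \<noteq> 0" using v by (auto simp: J_def complex_eq_iff)
    with det show False by simp
  qed
  have v': "Im \<tau>' = Im \<tau> / (norm J)\<^sup>2"
    using Im_moebius[OF det] J unfolding \<tau>'_def J_def by simp
  then have v'pos: "Im \<tau>' > 0" using v J by simp
  define \<alpha> where "\<alpha> = complex_of_real (pi * real m / Im \<tau>)"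
  define \<alpha>' where "\<alpha>' = complex_of_real (pi * real m / Im \<tau>')"
  \<comment> \<open>By the formula for \<open>Im \<tau>'\<close>, the left side is
    \<open>\<alpha> * cnj J / J\<close>. Here \<open>cnj J\<close> differs from \<open>J\<close> by
    \<open>2 * \<i> * c * Im \<tau>\<close>, and \<open>\<alpha> * Im \<tau> = pi * m\<close> no
    longer depends on \<tau>: the correction is the exponent in the Jacobi law.\<close>
  have weight: "\<alpha>' / J\<^sup>2 = \<alpha> - 2 * of_real pi * \<i> * of_nat m * of_int c / J"
  proof -
    have "cnj J = J - 2 * \<i> * of_int c * of_real (Im \<tau>)"
      by (simp add: J_def complex_eq_iff)
    moreover have "\<alpha>' = \<alpha> * (J * cnj J)"
      unfolding \<alpha>_def \<alpha>'_def v' complex_norm_square[symmetric] by simp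
    ultimately have "\<alpha>' / J\<^sup>2 = \<alpha> * (J - 2 * \<i> * of_int c * of_real (Im \<tau>)) / J"
      using J by (simp add: power2_eq_square)
    also have "\<dots> = \<alpha> - 2 * \<i> * of_int c * (\<alpha> * of_real (Im \<tau>)) / J"
      using J by (simp add: field_simps)
    also have "\<alpha> * of_real (Im \<tau>) = of_real pi * of_nat m"
      using v by (simp add: \<alpha>_def)
    finally show ?thesis by (simp add: mult_ac)
  qed
  have inv: "exp (\<alpha>' / J\<^sup>2 * z\<^sup>2) * \<phi> (z / J) \<tau>' = J ^ k * (exp (\<alpha> * z\<^sup>2) * \<phi> z \<tau>)" for z
  proof -
    have "\<phi> (z / J) \<tau>' = J ^ k * exp (2 * of_real pi * \<i> * of_nat m * of_int c * z\<^sup>2 / J) * \<phi> z \<tau>"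
      using assms(1) \<tau> det unfolding jacobi_transformation_laws_def J_def \<tau>'_def by blast
    moreover have "exp (\<alpha> * z\<^sup>2) = exp (\<alpha>' / J\<^sup>2 * z\<^sup>2) * exp (2 * of_real pi * \<i> * of_nat m * of_int c * z\<^sup>2 / J)"
      unfolding weight exp_add[symmetric] by (simp add: algebra_simps)
    ultimately show ?thesis by simp
  qed
  obtain r N where "punctured_expansion (\<lambda>z. \<phi> z \<tau>) (\<lambda>l w. X l w \<tau>) r N"
    using has_z_expansionE[OF assms(2) v] .
  \<comment> \<open>The same circle means are computed twice: here from the expansion at \<tau>, and
    for \<open>lim2\<close> from the rescaled expansion at \<open>\<tau>'\<close>.\<close>
  then have "((\<lambda>\<rho>. J ^ k * circle_mean (\<lambda>z. exp (\<alpha> * z\<^sup>2) * \<phi> z \<tau> * z powi (-n)) \<rho>)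
      \<longlongrightarrow> J ^ k * (\<Sum>j. \<alpha> ^ j / fact j * X (n - 2 * int j) 0 \<tau>)) (at_right 0)"
    by (intro tendsto_intros punctured_expansion.circle_mean_exp_tendsto)
  moreover have "J ^ k * circle_mean (\<lambda>z. exp (\<alpha> * z\<^sup>2) * \<phi> z \<tau> * z powi (-n)) \<rho> =
      circle_mean (\<lambda>z. exp (\<alpha>' / J\<^sup>2 * z\<^sup>2) * \<phi> (z / J) \<tau>' * z powi (-n)) \<rho>" for \<rho>
    unfolding circle_mean_cmult[symmetric] inv by (simp add: mult_ac)
  moreover have "(\<Sum>j. \<alpha> ^ j / fact j * X (n - 2 * int j) 0 \<tau>) = psi_coeff m X n \<tau>"
    unfolding psi_coeff_def \<alpha>_def by simp
  ultimately have lim1: "((\<lambda>\<rho>. circle_mean (\<lambda>z. exp (\<alpha>' / J\<^sup>2 * z\<^sup>2) * \<phi> (z / J) \<tau>' * z powi (-n)) \<rho>)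
      \<longlongrightarrow> J ^ k * psi_coeff m X n \<tau>) (at_right 0)"
    by simp
  obtain r' N' where exp': "punctured_expansion (\<lambda>z. \<phi> z \<tau>') (\<lambda>l w. X l w \<tau>') r' N'"
    using has_z_expansionE[OF assms(2) v'pos] .
  have lim2: "((\<lambda>\<rho>. circle_mean (\<lambda>z. exp (\<alpha>' / J\<^sup>2 * z\<^sup>2) * \<phi> (z / J) \<tau>' * z powi (-n)) \<rho>)
      \<longlongrightarrow> (\<Sum>j. (\<alpha>' / J\<^sup>2) ^ j / fact j * (X (n - 2 * int j) (0 / cnj J) \<tau>' * J powi (-(n - 2 * int j))))) (at_right 0)"
    by (rule punctured_expansion.circle_mean_exp_tendsto[OF punctured_expansion.rescale[OF exp' J]])
  \<comment> \<open>The powers \<open>J ^ (2 * j)\<close> from exponential and coefficient cancel.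
    The common factor \<open>J powi (-n)\<close> that remains is the source of the extra weight
    \<open>n\<close>.\<close>
  have summand: "(\<alpha>' / J\<^sup>2) ^ j / fact j * (X (n - 2 * int j) (0 / cnj J) \<tau>' * J powi (-(n - 2 * int j))) =
      J powi (-n) * (\<alpha>' ^ j / fact j * X (n - 2 * int j) 0 \<tau>')" for j
  proof -
    have "J powi (2 * int j) = (J\<^sup>2) ^ j"
      by (metis of_nat_mult of_nat_numeral power_int_of_nat power_mult)
    then have "J powi (-(n - 2 * int j)) = J powi (-n) * (J\<^sup>2) ^ j"
      using J by (simp add: power_int_diff power_int_minus field_simps)
    then show ?thesis using J by (simp add: power_divide)
  qed
  interpret E': punctured_expansion "\<lambda>z. \<phi> z \<tau>'" "\<lambda>l w. X l w \<tau>'" r' N' by fact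
  \<comment> \<open>Only finitely many summands are nonzero, so the common factor may be taken out
    of the series.\<close>
  have "summable (\<lambda>j. \<alpha>' ^ j / fact j * X (n - 2 * int j) 0 \<tau>')"
    using E'.vanish[of _ 0] E'.r_pos by (intro summable_finite[of "{..nat (n - N')}"]) auto
  then have "(\<Sum>j. J powi (-n) * (\<alpha>' ^ j / fact j * X (n - 2 * int j) 0 \<tau>')) = J powi (-n) * psi_coeff m X n \<tau>'"
    unfolding psi_coeff_def \<alpha>'_def by (subst suminf_mult) auto
  with lim2 have "((\<lambda>\<rho>. circle_mean (\<lambda>z. exp (\<alpha>' / J\<^sup>2 * z\<^sup>2) * \<phi> (z / J) \<tau>' * z powi (-n)) \<rho>)
      \<longlongrightarrow> J powi (-n) * psi_coeff m X n \<tau>') (at_right 0)"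
    unfolding summand by simp
  then have "J powi (-n) * psi_coeff m X n \<tau>' = J ^ k * psi_coeff m X n \<tau>"
    using lim1 by (intro tendsto_unique) auto
  then have "psi_coeff m X n \<tau>' = J powi (int k + n) * psi_coeff m X n \<tau>"
    using J by (simp add: power_int_add power_int_minus field_simps)
  then show "psi_coeff m X n ((of_int a * \<tau> + of_int b) / (of_int c * \<tau> + of_int d)) =
      (of_int c * \<tau> + of_int d) powi (int k + n) * psi_coeff m X n \<tau>"
    unfolding \<tau>'_def J_def .
qed

end
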